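(* Let $d\ge 1$ and let $K\in \mathrm{KS}^2(\mathbb{R}^d\times\mathbb{R}^d)$ be a kernel represented by the series expansion $$K(x,y)=\sum_{n=1}^{\infty}\lambda_n Y_n(x)Y_n(y),\qquad x,y\in\mathbb{R}^d,$$ with $\lambda_n>0$ for $n=1,2,\ldots$, satisfying $\lambda_n=O\left(2^{-n(2d+1)}\right)$ as $n\to\infty$. Let $\iota_K:\mathcal{H}_K\to \mathrm{KS}^2(\mathbb{R}^d)$ be the inclusion of the reproducing kernel Hilbert space $\mathcal{H}_K$ of $K$. Then $$\limsup_{\epsilon\to 0^+}\frac{\log (\mathcal{C}(\epsilon, \iota_K ))}{[\log(1/\epsilon)]^{2}}\leq\frac{2}{2d+1}.$$
   Context: $\lambda(\cdot)$ is Lebesgue measure; $\log$ is the logarithm in base 2. $\mathbb{R}^d$ carries the maximum norm. Write $\mathbb{Q}^d=\{q_1,q_2,\ldots\}$ and let $B_n(q_i)$ be the closed cube centered at $q_i$ with edges parallel to the axes of length $2/(2^n\sqrt d)$. The cubes $\{B_n(q_i)\}_{n,i\ge1}$ are organized (lexicographic order on the pairs $(n,i)$) into a sequence $\{B_k\}_{k\ge1}$. For $f\in L^1(\mathbb{R}^d)$ put $F_k(f)=\int_{\mathbb{R}^d}\chi_{B_k}(x)f(x)\,dx$. The space $\mathrm{KS}^2(\mathbb{R}^d)$ (Kuelbs-Steadman-2 space) is the Hilbert space completion of $L^1(\mathbb{R}^d)$ with respect to the inner product $$\langle f,g\rangle_{KS2}=\sum_{k=1}^\infty 2^{-k}F_k(f)F_k(g).$$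 Likewise, $\mathrm{KS}^2(\mathbb{R}^d\times\mathbb{R}^d)$ is the completion of $L^1(\mathbb{R}^d\times\mathbb{R}^d)$ with respect to $\langle f,g\rangle_{KS2}=\sum_{k,j=1}^\infty 2^{-k-j}F_{k,j}(f)F_{k,j}(g)$, where $F_{k,j}(f)=\int_{\mathbb{R}^d\times\mathbb{R}^d}\chi_{B_k}(x)\chi_{B_j}(y)f(x,y)\,dx\,dy$. The functions $Y_k:=\frac{2^{(k-1)/2}}{\lambda(B_k)}\chi_{B_k}$, $k=1,2,\ldots$, are taken, as part of the setting, to form an orthonormal complete system (orthonormal basis) of $(\mathrm{KS}^2(\mathbb{R}^d),\langle\cdot,\cdot\rangle_{KS2})$. The reproducing kernel Hilbert space (RKHS) of $K$ is $$\mathcal{H}_K=\Big\{\sum_{n=1}^\infty c_n\sqrt{\lambda_n}\,Y_n:\{c_n\}\in\ell_2\Big\},\qquad \langle f,g\rangle_K=\sum_{n=1}^\infty c_nd_n$$ for $f=\sum_n c_n\sqrt{\lambda_n}Y_n$, $g=\sum_n d_n\sqrt{\lambda_n}Y_n$. Covering numbers: for a subset $A$ of a metric space $X$ and $\epsilon>0$, $\mathcal{C}(\epsilon,A)$ is the minimal number of balls of $X$ of radius $\epsilon$ which cover $A$. With $B_K$ the unit ball of $\mathcal{H}_K$, $\mathcal{C}(\epsilon,\iota_K):=\mathcal{C}(\epsilon,\iota_K(B_K))$, the image being considered in $\mathrm{KS}^2(\mathbb{R}^d)$.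
   Formalization: The Y_k are not orthonormal (overlapping cubes give positive inner products), so orthonormality is dropped and the norm of H_K uses coefficients of least l2 norm; the lexicographic order of the pairs (n,i) is no sequence, so any enumeration of the cubes is allowed. *)

theory Defs
  imports "HOL-Analysis.Analysis" "HOL-Library.Landau_Symbols" "HOL-Library.Extended_Nat"
begin

section \<open>The cubes\<close>

definition ks_cube :: "nat \<Rightarrow> real ^ 'd \<Rightarrow> (real ^ 'd) set" where
  "ks_cube n q =
     cbox (\<chi> i. q $ i - 1 / (2 ^ n * sqrt (real CARD('d))))
          (\<chi> i. q $ i + 1 / (2 ^ n * sqrt (real CARD('d))))"

text \<open>
  \<open>B 1, B 2, \<dots>\<close> lists the cubes \<open>ks_cube n (q i)\<close>, where \<open>q 1, q 2, \<dots>\<close> enumerates the rational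
  points. The lexicographic order of all pairs \<open>(n, i)\<close> is not of order type \<open>\<omega>\<close>, so it does not
  literally arrange them in a sequence; every bijection \<open>e\<close> from the indices onto the pairs is
  admitted. All sequences here start at index 1, and values at index 0 are ignored.
\<close>

definition ks_cube_sequence :: "(nat \<Rightarrow> (real ^ 'd) set) \<Rightarrow> bool" where
  "ks_cube_sequence B \<longleftrightarrow>
     (\<exists>q e. bij_betw q {1..} {x :: real ^ 'd. \<forall>i. x $ i \<in> \<rat>} \<and>
            bij_betw e {1..} ({1..} \<times> {1..} :: (nat \<times> nat) set) \<and>
            (\<forall>k\<ge>1. B k = ks_cube (fst (e k)) (q (snd (e k)))))"


section \<open>The Kuelbs-Steadman spaces\<close>

definition ks_coeff :: "(nat \<Rightarrow> (real ^ 'd) set) \<Rightarrow> nat \<Rightarrow> (real ^ 'd \<Rightarrow> real) \<Rightarrow> real" where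
  "ks_coeff B k f = (LINT x|lborel. indicator (B k) x * f x)"

definition ks_inner :: "(nat \<Rightarrow> (real ^ 'd) set) \<Rightarrow> (real ^ 'd \<Rightarrow> real) \<Rightarrow> (real ^ 'd \<Rightarrow> real) \<Rightarrow> real" where
  "ks_inner B f g = (\<Sum>\<^sub>\<infinity>k\<in>{1..}. (1 / 2) ^ k * ks_coeff B k f * ks_coeff B k g)"

definition ks_coeff2 ::
    "(nat \<Rightarrow> (real ^ 'd) set) \<Rightarrow> nat \<Rightarrow> nat \<Rightarrow> ((real ^ 'd) \<times> (real ^ 'd) \<Rightarrow> real) \<Rightarrow> real" where
  "ks_coeff2 B k j f = (LINT (x, y)|lborel. indicator (B k) x * indicator (B j) y * f (x, y))"

definition ks_inner2 ::
    "(nat \<Rightarrow> (real ^ 'd) set) \<Rightarrow> ((real ^ 'd) \<times> (real ^ 'd) \<Rightarrow> real)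
       \<Rightarrow> ((real ^ 'd) \<times> (real ^ 'd) \<Rightarrow> real) \<Rightarrow> real" where
  "ks_inner2 B f g =
     (\<Sum>\<^sub>\<infinity>(k, j)\<in>{1..} \<times> {1..}. (1 / 2) ^ (k + j) * ks_coeff2 B k j f * ks_coeff2 B k j g)"

text \<open>
  \<open>J\<close> exhibits the Hilbert space \<open>'h\<close> as the completion of \<open>L\<^sup>1\<close> with respect to \<open>ip\<close>. The elements
  of \<open>L\<^sup>1\<close> are represented by integrable functions; \<open>J\<close> identifies functions that agree almost
  everywhere. Hilbert space completions are unique up to isometric isomorphism, so statements about
  the completion are made for every such \<open>'h\<close> and \<open>J\<close>.
\<close>

definition L1_completion ::
    "(('a::euclidean_space \<Rightarrow> real) \<Rightarrow> ('a \<Rightarrow> real) \<Rightarrow> real)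
       \<Rightarrow> (('a \<Rightarrow> real) \<Rightarrow> 'h::{real_inner, complete_space}) \<Rightarrow> bool" where
  "L1_completion ip J \<longleftrightarrow>
     (\<forall>f g. integrable lborel f \<longrightarrow> integrable lborel g \<longrightarrow> J (\<lambda>x. f x + g x) = J f + J g) \<and>
     (\<forall>a f. integrable lborel f \<longrightarrow> J (\<lambda>x. a * f x) = a *\<^sub>R J f) \<and>
     (\<forall>f g. integrable lborel f \<longrightarrow> integrable lborel g \<longrightarrow> J f \<bullet> J g = ip f g) \<and>
     closure (J ` {f. integrable lborel f}) = UNIV"

definition ks_Y :: "(nat \<Rightarrow> (real ^ 'd) set) \<Rightarrow> nat \<Rightarrow> real ^ 'd \<Rightarrow> real" where
  "ks_Y B k = (\<lambda>x. 2 powr ((real k - 1) / 2) / measure lborel (B k) * indicator (B k) x)"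


section \<open>The reproducing kernel Hilbert space\<close>

definition ell2 :: "(nat \<Rightarrow> real) set" where
  "ell2 = {c. (\<lambda>n. (c n)\<^sup>2) summable_on {1..}}"

definition rkhs_expansion ::
    "(nat \<Rightarrow> 'h::real_inner) \<Rightarrow> (nat \<Rightarrow> real) \<Rightarrow> 'h \<Rightarrow> (nat \<Rightarrow> real) \<Rightarrow> bool" where
  "rkhs_expansion Y lam f c \<longleftrightarrow>
     c \<in> ell2 \<and> ((\<lambda>n. (c n * sqrt (lam n)) *\<^sub>R Y n) has_sum f) {1..}"

definition rkhs :: "(nat \<Rightarrow> 'h::real_inner) \<Rightarrow> (nat \<Rightarrow> real) \<Rightarrow> 'h set" where
  "rkhs Y lam = {f. \<exists>c. rkhs_expansion Y lam f c}"

text \<open>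
  For an orthonormal \<open>Y\<close> the coefficients of \<open>f\<close> are unique, and \<open>rkhs_inner\<close> is
  \<open>\<Sum>\<^sub>n c\<^sub>n d\<^sub>n\<close> for the coefficients of \<open>f\<close> and \<open>g\<close> (lemma \<open>rkhs_inner_orthonormal\<close>). The
  functions \<open>ks_Y B k\<close>, however, are never orthonormal for \<open>ks_inner\<close>
  (lemma \<open>ks_Y_not_orthonormal\<close>); they are even linearly dependent, since a cube is, up to a null
  set, the disjoint union of \<open>2 ^ d\<close> cubes of half the edge length. Orthonormality of the
  \<open>Y\<^sub>k\<close> as a hypothesis would hence be contradictory, and it is not assumed. In general the
  coefficient sequence of least norm is taken, which turns \<open>rkhs Y lam\<close> into the quotient of
  \<open>\<ell>\<^sub>2\<close> by the kernel of \<open>c \<mapsto> \<Sum>\<^sub>n c\<^sub>n \<surd>\<lambda>\<^sub>n Y\<^sub>n\<close>: the space with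
  reproducing kernel \<open>\<Sum>\<^sub>n \<lambda>\<^sub>n Y\<^sub>n \<otimes> Y\<^sub>n\<close>.
\<close>

definition rkhs_coeffs ::
    "(nat \<Rightarrow> 'h::real_inner) \<Rightarrow> (nat \<Rightarrow> real) \<Rightarrow> 'h \<Rightarrow> nat \<Rightarrow> real" where
  "rkhs_coeffs Y lam f = (ARG_MIN (\<lambda>c. \<Sum>\<^sub>\<infinity>n\<in>{1..}. (c n)\<^sup>2) c. rkhs_expansion Y lam f c)"

definition rkhs_inner :: "(nat \<Rightarrow> 'h::real_inner) \<Rightarrow> (nat \<Rightarrow> real) \<Rightarrow> 'h \<Rightarrow> 'h \<Rightarrow> real" where
  "rkhs_inner Y lam f g = (\<Sum>\<^sub>\<infinity>n\<in>{1..}. rkhs_coeffs Y lam f n * rkhs_coeffs Y lam g n)"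

definition rkhs_unit_ball :: "(nat \<Rightarrow> 'h::real_inner) \<Rightarrow> (nat \<Rightarrow> real) \<Rightarrow> 'h set" where
  "rkhs_unit_ball Y lam = {f \<in> rkhs Y lam. sqrt (rkhs_inner Y lam f f) \<le> 1}"

lemma rkhs_expansion_orthonormal:
  fixes Y :: "nat \<Rightarrow> 'h::real_inner"
  assumes on: "\<And>m n. m \<ge> 1 \<Longrightarrow> n \<ge> 1 \<Longrightarrow> Y m \<bullet> Y n = (if m = n then 1 else 0)"
    and c: "rkhs_expansion Y lam f c" and n: "n \<ge> 1"
  shows "c n * sqrt (lam n) = f \<bullet> Y n"
proof -
  have "((\<lambda>m. (c m * sqrt (lam m)) *\<^sub>R Y m) has_sum f) {1..}"
    using c by (simp add: rkhs_expansion_def)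
  then have "((\<lambda>m. ((c m * sqrt (lam m)) *\<^sub>R Y m) \<bullet> Y n) has_sum f \<bullet> Y n) {1..}"
    using has_sum_bounded_linear[OF bounded_linear_inner_left] by blast
  moreover have "((\<lambda>m. ((c m * sqrt (lam m)) *\<^sub>R Y m) \<bullet> Y n) has_sum c n * sqrt (lam n)) {1..}"
  proof -
    have "((\<lambda>m. ((c m * sqrt (lam m)) *\<^sub>R Y m) \<bullet> Y n) has_sum
             (\<Sum>m\<in>{n}. ((c m * sqrt (lam m)) *\<^sub>R Y m) \<bullet> Y n)) {n}"
      by (rule has_sum_finite) simp
    then have "((\<lambda>m. ((c m * sqrt (lam m)) *\<^sub>R Y m) \<bullet> Y n) has_sum
             (\<Sum>m\<in>{n}. ((c m * sqrt (lam m)) *\<^sub>R Y m) \<bullet> Y n)) {1..}"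
      by (rule has_sum_cong_neutral[THEN iffD1, rotated -1]) (use n on in auto)
    then show ?thesis using n on by simp
  qed
  ultimately show ?thesis using has_sum_unique by blast
qed

lemma rkhs_inner_orthonormal:
  fixes Y :: "nat \<Rightarrow> 'h::real_inner"
  assumes on: "\<And>m n. m \<ge> 1 \<Longrightarrow> n \<ge> 1 \<Longrightarrow> Y m \<bullet> Y n = (if m = n then 1 else 0)"
    and lam: "\<And>n. n \<ge> 1 \<Longrightarrow> lam n > 0"
    and c: "rkhs_expansion Y lam f c" and d: "rkhs_expansion Y lam g d"
  shows "rkhs_inner Y lam f g = (\<Sum>\<^sub>\<infinity>n\<in>{1..}. c n * d n)"
proof -
  have uniq: "c n = c' n"
    if "rkhs_expansion Y lam f c" "rkhs_expansion Y lam f c'" "n \<ge> 1" for f c c' n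
    using rkhs_expansion_orthonormal[OF on that(1,3)] rkhs_expansion_orthonormal[OF on that(2,3)]
      lam[OF that(3)] by (metis mult_right_cancel real_sqrt_eq_zero_cancel_iff less_irrefl)
  have coeffs: "rkhs_coeffs Y lam f n = c n" if e: "rkhs_expansion Y lam f c" and n: "n \<ge> 1" for f c n
  proof -
    have "is_arg_min (\<lambda>c. \<Sum>\<^sub>\<infinity>n\<in>{1..}. (c n)\<^sup>2) (rkhs_expansion Y lam f) c"
      unfolding is_arg_min_def
    proof (intro conjI notI, rule e, elim exE conjE)
      fix c' assume c': "rkhs_expansion Y lam f c'"
        and less: "(\<Sum>\<^sub>\<infinity>n\<in>{1..}. (c' n)\<^sup>2) < (\<Sum>\<^sub>\<infinity>n\<in>{1..}. (c n)\<^sup>2)"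
      have "(\<Sum>\<^sub>\<infinity>n\<in>{1..}. (c' n)\<^sup>2) = (\<Sum>\<^sub>\<infinity>n\<in>{1..}. (c n)\<^sup>2)"
        using uniq[OF c' e] by (intro infsum_cong) simp
      with less show False by simp
    qed
    then have "is_arg_min (\<lambda>c. \<Sum>\<^sub>\<infinity>n\<in>{1..}. (c n)\<^sup>2) (rkhs_expansion Y lam f) (rkhs_coeffs Y lam f)"
      unfolding rkhs_coeffs_def arg_min_def by (metis someI)
    then have "rkhs_expansion Y lam f (rkhs_coeffs Y lam f)"
      by (simp add: is_arg_min_def)
    from uniq[OF this e n] show ?thesis .
  qed
  show ?thesis
    unfolding rkhs_inner_def using coeffs[OF c] coeffs[OF d] by (intro infsum_cong) simp
qed

lemma ks_Y_not_orthonormal: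
  fixes B :: "nat \<Rightarrow> (real ^ 'd) set"
  assumes B: "ks_cube_sequence B"
  shows "\<exists>k\<ge>1. \<exists>j\<ge>1. k \<noteq> j \<and> ks_inner B (ks_Y B k) (ks_Y B j) > 0"
proof -
  obtain q e where q: "bij_betw q {1..} {x :: real ^ 'd. \<forall>i. x $ i \<in> \<rat>}"
    and e: "bij_betw e {1..} ({1..} \<times> {1..} :: (nat \<times> nat) set)"
    and Be: "\<And>k. k \<ge> 1 \<Longrightarrow> B k = ks_cube (fst (e k)) (q (snd (e k)))"
    using B unfolding ks_cube_sequence_def by auto
  have "(1, 1) \<in> e ` {1..}" "(2, 1) \<in> e ` {1..}"
    using e by (auto simp: bij_betw_def)
  then obtain k j where k: "k \<ge> 1" "e k = (1, 1)" and j: "j \<ge> 1" "e j = (2, 1)"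
    by (metis atLeast_iff imageE)
  define r where "r n = 1 / (2 ^ n * sqrt (real CARD('d)))" for n :: nat
  have r: "r n > 0" for n by (simp add: r_def)
  have cube: "ks_cube n p = cbox (\<chi> i. p $ i - r n) (\<chi> i. p $ i + r n)" for n and p :: "real ^ 'd"
    by (simp add: ks_cube_def r_def)
  have meas: "B m \<in> sets lborel" "emeasure lborel (B m) < \<infinity>" "measure lborel (B m) > 0"
    if "m \<ge> 1" for m
  proof -
    show "B m \<in> sets lborel"
      unfolding Be[OF that] cube by simp
    show "emeasure lborel (B m) < \<infinity>"
      unfolding Be[OF that] cube using emeasure_lborel_cbox_finite by auto
    show "measure lborel (B m) > 0"
      unfolding Be[OF that] cube content_pos_lt_eq
      using r[of "fst (e m)"] by (auto simp: Basis_vec_def inner_axis intro: add_strict_increasing)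
  qed
  have sub: "B j \<subseteq> B k"
  proof -
    have "r 2 \<le> r 1" by (simp add: r_def field_simps)
    then show ?thesis
      unfolding Be[OF k(1)] Be[OF j(1)] cube k j
      by (auto simp: mem_box_cart) (smt (verit))+
  qed
  define a where "a m = 2 powr ((real m - 1) / 2) / measure lborel (B m)" for m
  have a: "a m > 0" if "m \<ge> 1" for m using meas(3)[OF that] by (simp add: a_def)
  have F: "ks_coeff B m (ks_Y B l) = a l * measure lborel (B m \<inter> B l)" if "m \<ge> 1" "l \<ge> 1" for m l
  proof -
    have "ks_coeff B m (ks_Y B l) = (LINT x|lborel. a l * indicator (B m \<inter> B l) x)"
      unfolding ks_coeff_def ks_Y_def a_def
      by (intro Bochner_Integration.integral_cong) (auto simp: indicator_def)
    also have "\<dots> = a l * measure lborel (B m \<inter> B l)"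
      using meas that by simp
    finally show ?thesis .
  qed
  define t where "t m = (1 / 2) ^ m * ks_coeff B m (ks_Y B k) * ks_coeff B m (ks_Y B j)" for m
  define M where "M = a k * measure lborel (B k) * (a j * measure lborel (B j))"
  have t0: "t m \<ge> 0" if "m \<ge> 1" for m
    using a[OF k(1)] a[OF j(1)] by (simp add: t_def F[OF that k(1)] F[OF that j(1)])
  have tM: "t m \<le> (1 / 2) ^ m * M" if "m \<ge> 1" for m
  proof -
    have "measure lborel (B m \<inter> B l) \<le> measure lborel (B l)" if "l \<ge> 1" for l
      using meas[OF that] meas(1)[OF \<open>m \<ge> 1\<close>]
      by (intro measure_mono_fmeasurable) (auto simp: fmeasurable_def)
    then have "a k * measure lborel (B m \<inter> B k) * (a j * measure lborel (B m \<inter> B j)) \<le> M"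
      unfolding M_def using a[OF k(1)] a[OF j(1)] k j
      by (intro mult_mono mult_nonneg_nonneg order_refl) auto
    then show ?thesis by (simp add: t_def F[OF that k(1)] F[OF that j(1)] mult.assoc)
  qed
  have "(\<lambda>m. (1 / 2 :: real) ^ m * M) summable_on {1..}"
  proof -
    have "summable (\<lambda>m. norm ((1 / 2 :: real) ^ m * M))"
      by (simp add: abs_mult power_abs summable_mult2 summable_geometric)
    then have "(\<lambda>m. (1 / 2 :: real) ^ m * M) summable_on UNIV"
      by (rule norm_summable_imp_summable_on)
    then show ?thesis by (rule summable_on_subset_banach) simp
  qed
  then have sum: "t summable_on {1..}"
    by (rule summable_on_comparison_test) (use t0 tM in auto)
  have "0 < t k"
    using a[OF k(1)] a[OF j(1)] meas(3)[OF k(1)] meas(3)[OF j(1)] sub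
    by (simp add: t_def F[OF k(1) k(1)] F[OF k(1) j(1)] Int_absorb1)
  also have "t k = sum t {k}" by simp
  also have "\<dots> \<le> infsum t {1..}"
    by (rule finite_sum_le_infsum) (use sum k t0 in auto)
  finally have "ks_inner B (ks_Y B k) (ks_Y B j) > 0"
    unfolding ks_inner_def t_def .
  moreover have "k \<noteq> j" using k j by auto
  ultimately show ?thesis using k j by blast
qed


section \<open>Covering numbers\<close>

text \<open>The value is \<open>\<infinity>\<close> if no finite cover exists.\<close>

definition covering_number :: "real \<Rightarrow> 'a::metric_space set \<Rightarrow> enat" where
  "covering_number \<epsilon> A = (INF S\<in>{S. finite S \<and> A \<subseteq> (\<Union>x\<in>S. ball x \<epsilon>)}. enat (card S))"

definition log2_enat :: "enat \<Rightarrow> ereal" where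
  "log2_enat N = (case N of enat n \<Rightarrow> ereal (log 2 (real n)) | \<infinity> \<Rightarrow> \<infinity>)"

end

theory Submission
  imports Defs "HOL-Real_Asymp.Real_Asymp"
begin

text \<open>
  Put \<open>v\<^sub>n = \<surd>\<lambda>\<^sub>n Y\<^sub>n\<close>. Without orthonormality one still has
  \<open>\<parallel>Y\<^sub>n\<parallel>\<^sup>2 \<le> 2\<^bsup>n-1\<^esup>\<close>, hence \<open>\<parallel>v\<^sub>n\<parallel> \<le> A 2\<^bsup>-nd\<^esup>\<close>. Every element of the unit ball is
  \<open>\<Sum>\<^sub>n c\<^sub>n v\<^sub>n\<close> with \<open>\<bar>c\<^sub>n\<bar> \<le> 1\<close>. With \<open>L = log (1/\<epsilon>)\<close>, cut the series at \<open>N \<approx> L/d\<close> and round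
  \<open>c\<^sub>n\<close> to a grid of about \<open>4 N A 2\<^bsup>-nd\<^esup>/\<epsilon>\<close> points. The logarithm of the number of grid vectors is
  \<open>\<Sum>\<^sub>n\<^sub>\<le>\<^sub>N (L - n d + O(log N)) \<sim> L\<^sup>2/(2d)\<close>, and \<open>1/(2d) \<le> 2/(2d+1)\<close>.
\<close>

section \<open>Coefficient sequences of least norm\<close>

lemma ell2_coord_le:
  assumes "c \<in> ell2" "n \<ge> 1"
  shows "(c n)\<^sup>2 \<le> (\<Sum>\<^sub>\<infinity>n\<in>{1..}. (c n)\<^sup>2)"
  using finite_sum_le_infsum[of "\<lambda>n. (c n)\<^sup>2" "{1..}" "{n}"] assms by (auto simp: ell2_def)

text \<open>The sequences representing \<open>f\<close> form a convex set, so midpoints compete in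
  the minimization. The inequality is the parallelogram law with all but one coordinate of the
  difference dropped; it makes near-minimal sequences close, uniformly in the coordinate.\<close>

lemma rkhs_expansion_midpoint:
  assumes c: "rkhs_expansion Y lam f c" and d: "rkhs_expansion Y lam f d"
  shows "rkhs_expansion Y lam f (\<lambda>n. (c n + d n) / 2)"
    and "n \<ge> 1 \<Longrightarrow> (c n - d n)\<^sup>2 + 4 * (\<Sum>\<^sub>\<infinity>n\<in>{1..}. ((c n + d n) / 2)\<^sup>2)
           \<le> 2 * (\<Sum>\<^sub>\<infinity>n\<in>{1..}. (c n)\<^sup>2) + 2 * (\<Sum>\<^sub>\<infinity>n\<in>{1..}. (d n)\<^sup>2)"
proof -
  have c2: "(\<lambda>n. (c n)\<^sup>2) summable_on {1..}" and d2: "(\<lambda>n. (d n)\<^sup>2) summable_on {1..}"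
    using c d by (auto simp: rkhs_expansion_def ell2_def)
  have s: "(\<lambda>n. 2 * (c n)\<^sup>2 + 2 * (d n)\<^sup>2) summable_on {1..}"
    by (intro summable_on_add summable_on_cmult_right c2 d2)
  have para: "(c n - d n)\<^sup>2 + 4 * ((c n + d n) / 2)\<^sup>2 = 2 * (c n)\<^sup>2 + 2 * (d n)\<^sup>2" for n
    by (simp add: power2_eq_square field_simps)
  have e2: "(\<lambda>n. ((c n + d n) / 2)\<^sup>2) summable_on {1..}"
    by (rule summable_on_comparison_test[OF s])
       (use para in \<open>smt (verit) zero_le_power2\<close>)+
  have m2: "(\<lambda>n. (c n - d n)\<^sup>2) summable_on {1..}"
    by (rule summable_on_comparison_test[OF s])
       (use para in \<open>smt (verit) zero_le_power2\<close>)+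
  show "rkhs_expansion Y lam f (\<lambda>n. (c n + d n) / 2)"
    unfolding rkhs_expansion_def
  proof
    show "(\<lambda>n. (c n + d n) / 2) \<in> ell2" using e2 by (simp add: ell2_def)
    have "((\<lambda>n. (1/2) *\<^sub>R ((c n * sqrt (lam n)) *\<^sub>R Y n + (d n * sqrt (lam n)) *\<^sub>R Y n))
            has_sum (1/2) *\<^sub>R (f + f)) {1..}"
      using c d by (intro has_sum_scaleR has_sum_add) (auto simp: rkhs_expansion_def)
    moreover have "(1/2) *\<^sub>R (f + f) = f"
      by (simp flip: scaleR_2)
    ultimately show "((\<lambda>n. ((c n + d n) / 2 * sqrt (lam n)) *\<^sub>R Y n) has_sum f) {1..}"
      by (simp add: algebra_simps add_divide_distrib)
  qed
  show "(c n - d n)\<^sup>2 + 4 * (\<Sum>\<^sub>\<infinity>n\<in>{1..}. ((c n + d n) / 2)\<^sup>2)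
           \<le> 2 * (\<Sum>\<^sub>\<infinity>n\<in>{1..}. (c n)\<^sup>2) + 2 * (\<Sum>\<^sub>\<infinity>n\<in>{1..}. (d n)\<^sup>2)" if "n \<ge> 1"
  proof -
    have "(c n - d n)\<^sup>2 + 4 * (\<Sum>\<^sub>\<infinity>n\<in>{1..}. ((c n + d n) / 2)\<^sup>2)
        \<le> (\<Sum>\<^sub>\<infinity>n\<in>{1..}. (c n - d n)\<^sup>2) + (\<Sum>\<^sub>\<infinity>n\<in>{1..}. 4 * ((c n + d n) / 2)\<^sup>2)"
      using ell2_coord_le[of "\<lambda>n. c n - d n" n] m2 that infsum_cmult_right[OF e2, of 4]
      by (simp add: ell2_def)
    also have "\<dots> = (\<Sum>\<^sub>\<infinity>n\<in>{1..}. (c n - d n)\<^sup>2 + 4 * ((c n + d n) / 2)\<^sup>2)"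
      by (rule infsum_add[symmetric, OF m2 summable_on_cmult_right[OF e2]])
    also have "\<dots> = (\<Sum>\<^sub>\<infinity>n\<in>{1..}. 2 * (c n)\<^sup>2 + 2 * (d n)\<^sup>2)"
      by (simp only: para)
    also have "\<dots> = (\<Sum>\<^sub>\<infinity>n\<in>{1..}. 2 * (c n)\<^sup>2) + (\<Sum>\<^sub>\<infinity>n\<in>{1..}. 2 * (d n)\<^sup>2)"
      by (intro infsum_add summable_on_cmult_right c2 d2)
    finally show ?thesis
      by (simp only: infsum_cmult_right[OF c2] infsum_cmult_right[OF d2])
  qed
qed

text \<open>
  \<open>ARG_MIN\<close> is only meaningful if the minimum is attained. By the parallelogram law a minimizing
  sequence converges coordinatewise and uniformly in the coordinate, and the limit represents \<open>f\<close>
  because \<open>\<Sum>\<^sub>n \<surd>\<lambda>\<^sub>n \<parallel>Y\<^sub>n\<parallel>\<close> converges.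
\<close>

lemma rkhs_coeffs_expansion:
  fixes Y :: "nat \<Rightarrow> 'h::real_inner"
  assumes summ: "(\<lambda>n. norm (sqrt (lam n) *\<^sub>R Y n)) summable_on {1..}" and f: "f \<in> rkhs Y lam"
  shows "rkhs_expansion Y lam f (rkhs_coeffs Y lam f)"
proof -
  define S where "S c = (\<Sum>\<^sub>\<infinity>n\<in>{1..}. (c n)\<^sup>2)" for c :: "nat \<Rightarrow> real"
  define X where "X = S ` {c. rkhs_expansion Y lam f c}"
  define I where "I = Inf X"
  have ne: "X \<noteq> {}" using f by (auto simp: X_def rkhs_def)
  have "S c \<ge> 0" for c by (simp add: S_def infsum_nonneg)
  then have bdd: "bdd_below X" by (auto simp: X_def intro!: bdd_belowI[of _ 0])
  have I_le: "I \<le> S c" if "rkhs_expansion Y lam f c" for c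
    unfolding I_def using bdd that by (intro cInf_lower) (auto simp: X_def)
  have "\<exists>c. rkhs_expansion Y lam f c \<and> S c < I + inverse (Suc k)" for k
    using cInf_lessD[OF ne, of "I + inverse (Suc k)"] by (auto simp: I_def X_def)
  then obtain c where c: "\<And>k. rkhs_expansion Y lam f (c k)"
    and Sc: "\<And>k. S (c k) < I + inverse (Suc k)" by metis
  \<comment> \<open>The midpoint has square norm at least \<open>I\<close>, so \<open>4 * I\<close>
    cancels in the parallelogram inequality and only the excesses over \<open>I\<close>
    remain.\<close>
  have diff: "(c j n - c k n)\<^sup>2 \<le> 2 * inverse (Suc j) + 2 * inverse (Suc k)" if "n \<ge> 1" for j k n
    using rkhs_expansion_midpoint(2)[OF c[of j] c[of k] that, folded S_def] Sc[of j] Sc[of k]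
      I_le[OF rkhs_expansion_midpoint(1)[OF c[of j] c[of k]]] by linarith
  have "convergent (\<lambda>k. c k n)" if n: "n \<ge> 1" for n
  proof -
    have "Cauchy (\<lambda>k. c k n)"
    proof (rule metric_CauchyI)
      fix e :: real assume e: "e > 0"
      then obtain M where M: "inverse (Suc M) < e\<^sup>2 / 4"
        using reals_Archimedean[of "e\<^sup>2 / 4"] by auto
      have "dist (c j n) (c k n) < e" if "j \<ge> M" "k \<ge> M" for j k
      proof -
        have "inverse (real (Suc j)) \<le> inverse (real (Suc M))" "inverse (real (Suc k)) \<le> inverse (real (Suc M))"
          using that by (auto intro!: le_imp_inverse_le)
        then have "(c j n - c k n)\<^sup>2 < e\<^sup>2"
          using diff[OF n, of j k] M by linarith
        then show ?thesis using e power2_less_imp_less[of "\<bar>c j n - c k n\<bar>" e] by (simp add: dist_real_def)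
      qed
      then show "\<exists>M. \<forall>j\<ge>M. \<forall>k\<ge>M. dist (c j n) (c k n) < e" by blast
    qed
    then show ?thesis by (rule Cauchy_convergent)
  qed
  then obtain b where b: "\<And>n. n \<ge> 1 \<Longrightarrow> (\<lambda>k. c k n) \<longlonglongrightarrow> b n"
    unfolding convergent_def by metis
  have inv0: "(\<lambda>k. inverse (real (Suc k))) \<longlonglongrightarrow> 0" by (rule LIMSEQ_inverse_real_of_nat)
  \<comment> \<open>Lower semicontinuity: coordinatewise convergence controls finite partial sums
    only, but these suffice to bound the whole sum by \<open>I\<close>.\<close>
  have fin: "sum (\<lambda>n. (b n)\<^sup>2) F \<le> I" if F: "finite F" "F \<subseteq> {1..}" for F
  proof (rule LIMSEQ_le)
    show "(\<lambda>k. \<Sum>n\<in>F. (c k n)\<^sup>2) \<longlonglongrightarrow> (\<Sum>n\<in>F. (b n)\<^sup>2)"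
      using F by (intro tendsto_sum tendsto_power b) auto
    show "(\<lambda>k. I + inverse (real (Suc k))) \<longlonglongrightarrow> I"
      using tendsto_add[OF tendsto_const inv0, of I] by simp
    have "(\<Sum>n\<in>F. (c k n)\<^sup>2) \<le> I + inverse (Suc k)" for k
      using finite_sum_le_infsum[of "\<lambda>n. (c k n)\<^sup>2" "{1..}" F] c[of k] F Sc[of k]
      by (auto simp: rkhs_expansion_def ell2_def S_def)
    then show "\<exists>N. \<forall>k\<ge>N. (\<Sum>n\<in>F. (c k n)\<^sup>2) \<le> I + inverse (real (Suc k))" by blast
  qed
  have b2: "(\<lambda>n. (b n)\<^sup>2) summable_on {1..}"
    by (rule nonneg_bounded_partial_sums_imp_summable_on[where C = I])
       (use fin in \<open>auto intro!: eventually_finite_subsets_at_top_weakI\<close>)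
  have SbI: "S b \<le> I"
    unfolding S_def by (rule infsum_le_finite_sums[OF b2 fin])
  \<comment> \<open>Letting \<open>j\<close> tend to infinity in \<open>diff\<close> gives a rate
    common to all coordinates, which permits exchanging the series with the limit in
    \<open>k\<close>.\<close>
  have close: "\<bar>b n - c k n\<bar> \<le> sqrt (2 * inverse (Suc k))" if n: "n \<ge> 1" for k n
  proof -
    have "(b n - c k n)\<^sup>2 \<le> 2 * 0 + 2 * inverse (Suc k)"
    proof (rule LIMSEQ_le)
      show "(\<lambda>j. (c j n - c k n)\<^sup>2) \<longlonglongrightarrow> (b n - c k n)\<^sup>2"
        by (intro tendsto_intros b n)
      show "(\<lambda>j. 2 * inverse (real (Suc j)) + 2 * inverse (Suc k)) \<longlonglongrightarrow> 2 * 0 + 2 * inverse (Suc k)"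
        by (intro tendsto_intros inv0)
    qed (use diff n in auto)
    then show ?thesis using real_le_rsqrt real_sqrt_le_mono real_sqrt_abs
      by (metis add_0 mult_zero_right)
  qed
  define V where "V = (\<Sum>\<^sub>\<infinity>n\<in>{1..}. norm (sqrt (lam n) *\<^sub>R Y n))"
  have "rkhs_expansion Y lam f b"
    unfolding rkhs_expansion_def has_sum_def
  proof (intro conjI tendstoI)
    show "b \<in> ell2" using b2 by (simp add: ell2_def)
    fix e :: real assume e: "e > 0"
    \<comment> \<open>A uniform coefficient error costs at most that error times \<open>V\<close> in
      norm, for every finite \<open>F\<close>. Hence \<open>k\<close> is fixed first and
      \<open>F\<close> is enlarged afterwards.\<close>
    have "(\<lambda>k. sqrt (2 * inverse (real (Suc k))) * V) \<longlonglongrightarrow> sqrt (2 * 0) * V"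
      by (intro tendsto_intros inv0)
    then have "\<forall>\<^sub>F k in sequentially. sqrt (2 * inverse (real (Suc k))) * V < e / 2"
      using e by (intro order_tendstoD) auto
    then obtain k where k: "sqrt (2 * inverse (real (Suc k))) * V < e / 2"
      by (auto simp: eventually_sequentially)
    have "\<forall>\<^sub>F F in finite_subsets_at_top {1..}. dist (\<Sum>n\<in>F. (c k n * sqrt (lam n)) *\<^sub>R Y n) f < e / 2"
      using c[of k] e by (intro tendstoD) (auto simp: rkhs_expansion_def has_sum_def)
    moreover have "\<forall>\<^sub>F F in finite_subsets_at_top {1..}. finite F \<and> F \<subseteq> {1::nat..}"
      by (rule eventually_finite_subsets_at_top_weakI) auto
    ultimately show "\<forall>\<^sub>F F in finite_subsets_at_top {1..}. dist (\<Sum>n\<in>F. (b n * sqrt (lam n)) *\<^sub>R Y n) f < e"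
    proof eventually_elim
      case (elim F)
      then have F: "finite F" "F \<subseteq> {1..}" by auto
      have "dist (\<Sum>n\<in>F. (b n * sqrt (lam n)) *\<^sub>R Y n) (\<Sum>n\<in>F. (c k n * sqrt (lam n)) *\<^sub>R Y n)
          = norm (\<Sum>n\<in>F. (b n - c k n) *\<^sub>R (sqrt (lam n) *\<^sub>R Y n))"
        by (simp add: dist_norm sum_subtractf algebra_simps)
      also have "\<dots> \<le> (\<Sum>n\<in>F. sqrt (2 * inverse (Suc k)) * norm (sqrt (lam n) *\<^sub>R Y n))"
      proof (rule sum_norm_le)
        fix n assume "n \<in> F"
        then have "n \<ge> 1" using F by auto
        from mult_right_mono[OF close[OF this, of k] norm_ge_zero[of "sqrt (lam n) *\<^sub>R Y n"]]
        show "norm ((b n - c k n) *\<^sub>R (sqrt (lam n) *\<^sub>R Y n))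
            \<le> sqrt (2 * inverse (Suc k)) * norm (sqrt (lam n) *\<^sub>R Y n)"
          by (simp only: norm_scaleR[of "b n - c k n"])
      qed
      also have "\<dots> \<le> sqrt (2 * inverse (Suc k)) * V"
        unfolding V_def sum_distrib_left[symmetric]
        using F summ by (intro mult_left_mono finite_sum_le_infsum) auto
      finally show ?case using k elim(1) 
        by (smt (verit) dist_triangle field_sum_of_halves)
    qed
  qed
  moreover from this have "\<not> S d < S b" if "rkhs_expansion Y lam f d" for d
    using I_le[OF that] SbI by linarith
  ultimately have "is_arg_min S (rkhs_expansion Y lam f) b"
    by (auto simp: is_arg_min_def)
  \<comment> \<open>\<open>b\<close> only witnesses that a minimizer exists; the choice made in
    \<open>rkhs_coeffs\<close> is then also a minimizer, possibly different from \<open>b\<close> at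
    index 0.\<close>
  then have "is_arg_min S (rkhs_expansion Y lam f) (rkhs_coeffs Y lam f)"
    unfolding rkhs_coeffs_def arg_min_def S_def by (metis someI)
  then show ?thesis by (simp add: is_arg_min_def)
qed

text \<open>The square norm of \<open>f\<close> is that of its least sequence, and a sum of squares
  at most 1 bounds every coefficient by 1. The covering estimate works with this relaxation of the
  ball to a box.\<close>

lemma rkhs_unit_ballE:
  assumes "(\<lambda>n. norm (sqrt (lam n) *\<^sub>R Y n)) summable_on {1..}" and f: "f \<in> rkhs_unit_ball Y lam"
  obtains c where "\<And>n. n \<ge> 1 \<Longrightarrow> \<bar>c n\<bar> \<le> 1" "((\<lambda>n. c n *\<^sub>R (sqrt (lam n) *\<^sub>R Y n)) has_sum f) {1..}"
proof
  have e: "rkhs_expansion Y lam f (rkhs_coeffs Y lam f)"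
    using assms by (intro rkhs_coeffs_expansion) (auto simp: rkhs_unit_ball_def)
  then show "((\<lambda>n. rkhs_coeffs Y lam f n *\<^sub>R (sqrt (lam n) *\<^sub>R Y n)) has_sum f) {1..}"
    by (simp add: rkhs_expansion_def)
  show "\<bar>rkhs_coeffs Y lam f n\<bar> \<le> 1" if "n \<ge> 1" for n
    using ell2_coord_le[of "rkhs_coeffs Y lam f", OF _ that] e f
    by (auto simp: rkhs_expansion_def rkhs_unit_ball_def rkhs_inner_def power2_eq_square[symmetric]
        simp flip: abs_square_le_1)
qed

section \<open>Covering sets of series with bounded coefficients\<close>

lemma covering_number_le:
  assumes "finite S" "A \<subseteq> (\<Union>x\<in>S. ball x \<epsilon>)"
  shows "covering_number \<epsilon> A \<le> enat (card S)"
  unfolding covering_number_def using assms by (intro INF_lower) auto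

lemma log2_enat_le:
  assumes "N \<le> enat m" shows "log2_enat N \<le> ereal (log 2 (real m))"
proof (cases N)
  case (enat n)
  then have "n \<le> m" using assms by simp
  \<comment> \<open>Zero is split off because the empty set has covering number 0, where
    \<open>log 2\<close> takes its default value 0.\<close>
  then have "log 2 (real n) \<le> log 2 (real m)"
    by (cases "n = 0"; cases "m = 0") (auto simp: log_def divide_right_mono)
  then show ?thesis using enat by (simp add: log2_enat_def)
qed (use assms in auto)

text \<open>The grid points are the midpoints of \<open>m\<close> equal cells of [-1, 1], each of
  half-length \<open>1 / m\<close>.\<close>

lemma interval_grid:
  assumes "m > 0" "\<bar>x\<bar> \<le> (1::real)"
  shows "\<exists>i<m. \<bar>x - ((2 * real i + 1) / real m - 1)\<bar> \<le> 1 / real m"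
proof (cases "x = 1")
  \<comment> \<open>Rounding down would send the right endpoint to the index \<open>m\<close>,
    outside the range; it is put into the last cell.\<close>
  case True
  then show ?thesis using assms(1) by (intro exI[of _ "m - 1"]) (auto simp: field_simps of_nat_diff)
next
  case False
  define i where "i = nat \<lfloor>(x + 1) * m / 2\<rfloor>"
  have nn: "(x + 1) * m / 2 \<ge> 0" using assms by auto
  have i: "real i \<le> (x + 1) * m / 2" "(x + 1) * m / 2 < real i + 1"
    unfolding i_def using nn by linarith+
  have "(x + 1) * m / 2 < m" using False assms by (simp add: field_simps)
  with i have "i < m" by linarith
  moreover have "\<bar>x - ((2 * real i + 1) / real m - 1)\<bar> \<le> 1 / real m"
    using i assms(1) by (simp add: field_simps abs_le_iff)
  ultimately show ?thesis by blast
qed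

text \<open>Truncate at \<open>N\<close> and round each remaining coefficient to a grid of
  \<open>m n\<close> points. Every choice of grid points gives one centre; the \<open>n\<close>-th
  rounding costs \<open>norm (v n) / m n\<close> and the rest of the series costs
  \<open>T\<close>.\<close>

lemma covering_number_prod:
  fixes v :: "nat \<Rightarrow> 'h::real_normed_vector"
  assumes m: "\<And>n. n \<in> {1..N} \<Longrightarrow> m n > 0"
    and tail: "\<And>F. finite F \<Longrightarrow> F \<subseteq> {N<..} \<Longrightarrow> (\<Sum>n\<in>F. norm (v n)) \<le> T"
    and eps: "(\<Sum>n\<in>{1..N}. norm (v n) / m n) + T < \<epsilon>"
    and A: "\<And>f. f \<in> A \<Longrightarrow> \<exists>c. (\<forall>n\<ge>1. \<bar>c n\<bar> \<le> 1) \<and> ((\<lambda>n. c n *\<^sub>R v n) has_sum f) {1..}"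
  shows "covering_number \<epsilon> A \<le> enat (\<Prod>n\<in>{1..N}. m n)"
proof -
  define t where "t n i = (2 * real i + 1) / real (m n) - 1" for n i
  define p where "p g = (\<Sum>n\<in>{1..N}. t n (g n) *\<^sub>R v n)" for g
  define P where "P = (\<Pi>\<^sub>E n\<in>{1..N}. {..<m n})"
  have fin: "finite P" unfolding P_def by (intro finite_PiE) auto
  have "A \<subseteq> (\<Union>x\<in>p ` P. ball x \<epsilon>)"
  proof
    fix f assume "f \<in> A"
    then obtain c where c: "\<And>n. n \<ge> 1 \<Longrightarrow> \<bar>c n\<bar> \<le> 1" and f: "((\<lambda>n. c n *\<^sub>R v n) has_sum f) {1..}"
      using A by blast
    have "\<forall>n\<in>{1..N}. \<exists>i<m n. \<bar>c n - t n i\<bar> \<le> 1 / m n"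
      unfolding t_def using interval_grid m c by simp
    then obtain g0 where g0: "\<And>n. n \<in> {1..N} \<Longrightarrow> g0 n < m n \<and> \<bar>c n - t n (g0 n)\<bar> \<le> 1 / m n"
      by metis
    define g where "g = restrict g0 {1..N}"
    have gP: "g \<in> P" using g0 by (auto simp: P_def g_def)
    have g: "\<bar>c n - t n (g n)\<bar> \<le> 1 / m n" if "n \<in> {1..N}" for n
      using g0[OF that] that by (simp add: g_def)
    have part: "norm ((\<Sum>n\<in>F. c n *\<^sub>R v n) - p g) \<le> (\<Sum>n\<in>{1..N}. norm (v n) / m n) + T"
      if F: "finite F" "F \<subseteq> {1..}" "{1..N} \<subseteq> F" for F
    proof -
      have "(\<Sum>n\<in>F. c n *\<^sub>R v n) = (\<Sum>n\<in>F - {1..N}. c n *\<^sub>R v n) + (\<Sum>n\<in>{1..N}. c n *\<^sub>R v n)"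
        using F by (intro sum.subset_diff) auto
      then have "(\<Sum>n\<in>F. c n *\<^sub>R v n) - p g
          = (\<Sum>n\<in>{1..N}. (c n - t n (g n)) *\<^sub>R v n) + (\<Sum>n\<in>F - {1..N}. c n *\<^sub>R v n)"
        by (simp add: p_def sum_subtractf scaleR_diff_left)
      also have "norm \<dots> \<le> (\<Sum>n\<in>{1..N}. norm (v n) / m n) + (\<Sum>n\<in>F - {1..N}. norm (v n))"
      proof (intro norm_triangle_mono sum_norm_le)
        fix n assume "n \<in> {1..N}"
        from mult_right_mono[OF g[OF this], of "norm (v n)"]
        show "norm ((c n - t n (g n)) *\<^sub>R v n) \<le> norm (v n) / m n" by simp
      next
        fix n assume "n \<in> F - {1..N}"
        then have "\<bar>c n\<bar> \<le> 1" using F c by auto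
        then show "norm (c n *\<^sub>R v n) \<le> norm (v n)" by (simp add: mult_left_le_one_le)
      qed
      also have "(\<Sum>n\<in>F - {1..N}. norm (v n)) \<le> T"
        using F by (intro tail) (auto simp: subset_iff)
      finally show ?thesis by simp
    qed
    \<comment> \<open>Finite index sets containing \<open>{1..N}\<close> are cofinal, so the bound
      on partial sums passes to \<open>f\<close>. The limit may attain the bound; strictness in
      \<open>eps\<close> then places \<open>f\<close> in the open ball.\<close>
    have "norm (f - p g) \<le> (\<Sum>n\<in>{1..N}. norm (v n) / m n) + T"
    proof (rule tendsto_upperbound)
      show "((\<lambda>F. norm ((\<Sum>n\<in>F. c n *\<^sub>R v n) - p g)) \<longlongrightarrow> norm (f - p g)) (finite_subsets_at_top {1..})"
        using f unfolding has_sum_def by (intro tendsto_intros)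
      show "\<forall>\<^sub>F F in finite_subsets_at_top {1..}.
          norm ((\<Sum>n\<in>F. c n *\<^sub>R v n) - p g) \<le> (\<Sum>n\<in>{1..N}. norm (v n) / m n) + T"
        unfolding eventually_finite_subsets_at_top using part by (intro exI[of _ "{1..N}"]) auto
    qed simp
    then have "f \<in> ball (p g) \<epsilon>" using eps by (simp add: dist_norm norm_minus_commute)
    then show "f \<in> (\<Union>x\<in>p ` P. ball x \<epsilon>)" using gP by blast
  qed
  then have "covering_number \<epsilon> A \<le> enat (card (p ` P))"
    using fin by (intro covering_number_le) auto
  also have "card (p ` P) \<le> (\<Prod>n\<in>{1..N}. m n)"
    using card_image_le[OF fin, of p] by (simp add: P_def card_PiE)
  finally show ?thesis by simp
qed

section \<open>Geometric decay and the covering estimate it yields\<close>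

lemma sum_geometric_tail:
  assumes "finite F" "F \<subseteq> {N<..}" "d \<ge> (1::nat)"
  shows "(\<Sum>n\<in>F. (1 / 2 :: real) ^ (n * d)) \<le> (1 / 2) ^ (N * d)"
proof -
  have r: "(1 / 2 :: real) ^ d \<le> 1 / 2" using power_decreasing[of 1 d "1/2::real"] assms by simp
  define M where "M = Max F"
  have "n \<in> {N<..N + M}" if "n \<in> F" for n
    using assms that trans_le_add2[OF Max_ge[OF assms(1) that]] by (auto simp: M_def)
  then have "(\<Sum>n\<in>F. (1 / 2 :: real) ^ (n * d)) \<le> (\<Sum>n\<in>{N<..N+M}. (1 / 2) ^ (n * d))"
    by (intro sum_mono2) auto
  \<comment> \<open>Subtracting the last term makes the induction work: with ratio at most 1/2,
    twice the new term is at most the preceding one.\<close>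
  also have "\<dots> \<le> (1 / 2) ^ (N * d) - (1 / 2) ^ ((N + M) * d)"
  proof (induction M)
    case (Suc M)
    have "{N<..N + Suc M} = insert (N + Suc M) {N<..N + M}" by auto
    moreover have "2 * ((1 / 2 :: real) ^ ((N + Suc M) * d)) \<le> (1 / 2) ^ ((N + M) * d)"
      using mult_right_mono[OF r, of "(1 / 2) ^ ((N + M) * d)"] by (simp add: power_add)
    ultimately show ?case using Suc by simp
  qed simp
  also have "\<dots> \<le> (1 / 2 :: real) ^ (N * d)"
    by simp
  finally show ?thesis .
qed

text \<open>The \<open>m\<close>-th functional maps \<open>ks_Y B k\<close> to
  \<open>2 powr ((k - 1) / 2)\<close> times the fraction of \<open>B k\<close> inside
  \<open>B m\<close>, and the weights \<open>(1 / 2) ^ m\<close> sum to 1. This growth bound stands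
  in for orthonormality.\<close>

lemma norm_J_ks_Y_le:
  fixes B :: "nat \<Rightarrow> (real ^ 'd) set" and J :: "(real ^ 'd \<Rightarrow> real) \<Rightarrow> 'h::{real_inner, complete_space}"
  assumes B: "ks_cube_sequence B" and J: "L1_completion (ks_inner B) J" and k: "k \<ge> 1"
  shows "(norm (J (ks_Y B k)))\<^sup>2 \<le> 2 ^ (k - 1)"
proof -
  have meas: "B m \<in> sets lborel" "emeasure lborel (B m) < \<infinity>" if "m \<ge> 1" for m
    using B that emeasure_lborel_cbox_finite by (auto simp: ks_cube_sequence_def ks_cube_def)
  define a where "a = 2 powr ((real k - 1) / 2) / measure lborel (B k)"
  have Y: "ks_Y B k = (\<lambda>x. a * indicator (B k) x)" by (simp add: ks_Y_def a_def)
  have int: "integrable lborel (ks_Y B k)"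
    unfolding Y using meas[OF k] by (intro integrable_mult_right) (simp add: integrable_indicator_iff)
  have a0: "a \<ge> 0" by (simp add: a_def)
  have F: "ks_coeff B m (ks_Y B k) = a * measure lborel (B m \<inter> B k)" if "m \<ge> 1" for m
  proof -
    have "ks_coeff B m (ks_Y B k) = (LINT x|lborel. a * indicator (B m \<inter> B k) x)"
      unfolding ks_coeff_def Y
      by (intro Bochner_Integration.integral_cong) (auto simp: indicator_def)
    then show ?thesis using meas that k by simp
  qed
  have FM: "(ks_coeff B m (ks_Y B k))\<^sup>2 \<le> 2 ^ (k - 1)" if "m \<ge> 1" for m
  proof -
    have "measure lborel (B m \<inter> B k) \<le> measure lborel (B k)"
      using meas[OF k] meas(1)[OF \<open>m \<ge> 1\<close>]
      by (intro measure_mono_fmeasurable) (auto simp: fmeasurable_def)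
    then have "ks_coeff B m (ks_Y B k) \<le> a * measure lborel (B k)"
      using a0 by (simp add: F[OF that] mult_left_mono)
    \<comment> \<open>If the measure were 0, the quotient in \<open>a\<close> would default to 0 and
      the bound would still hold.\<close>
    also have "\<dots> \<le> 2 powr ((real k - 1) / 2)" by (simp add: a_def)
    finally have "(ks_coeff B m (ks_Y B k))\<^sup>2 \<le> (2 powr ((real k - 1) / 2))\<^sup>2"
      using a0 by (intro power_mono) (auto simp: F[OF that])
    also have "\<dots> = 2 powr (real (k - 1))"
      using k by (simp add: power2_eq_square of_nat_diff flip: powr_add)
    finally show ?thesis by (simp add: powr_realpow)
  qed
  have geo: "((\<lambda>m. (1 / 2 :: real) ^ m) has_sum 1) {1..}"
  proof -
    have "((\<lambda>m. (1 / 2 :: real) ^ Suc m) has_sum 1) UNIV"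
      using power_half_series by (intro sums_nonneg_imp_has_sum) auto
    moreover have "bij_betw Suc UNIV {1..}"
      by (auto simp: bij_betw_def image_iff) (metis Suc_le_D)
    ultimately show ?thesis
      using has_sum_reindex_bij_betw[of Suc UNIV "{1..}" "\<lambda>m. (1 / 2 :: real) ^ m" 1] by simp
  qed
  have geo': "((\<lambda>m. (1 / 2) ^ m * 2 ^ (k - 1)) has_sum 1 * (2 ^ (k - 1) :: real)) {1..}"
    using geo by (rule has_sum_cmult_left)
  have "(norm (J (ks_Y B k)))\<^sup>2 = ks_inner B (ks_Y B k) (ks_Y B k)"
    using J int by (simp add: L1_completion_def power2_norm_eq_inner)
  also have "\<dots> = (\<Sum>\<^sub>\<infinity>m\<in>{1..}. (1 / 2) ^ m * (ks_coeff B m (ks_Y B k))\<^sup>2)"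
    by (simp add: ks_inner_def power2_eq_square mult.assoc)
  also have "\<dots> \<le> (\<Sum>\<^sub>\<infinity>m\<in>{1..}. (1 / 2) ^ m * 2 ^ (k - 1))"
  proof (rule infsum_mono)
    show s: "(\<lambda>m. (1 / 2) ^ m * 2 ^ (k - 1) :: real) summable_on {1..}"
      using geo' by (rule has_sum_imp_summable)
    show "(\<lambda>m. (1 / 2) ^ m * (ks_coeff B m (ks_Y B k))\<^sup>2) summable_on {1..}"
      by (rule summable_on_comparison_test[OF s]) (use FM in auto)
  qed (use FM in auto)
  also have "\<dots> = 2 ^ (k - 1)" using infsumI[OF geo'] by simp
  finally show ?thesis .
qed

text \<open>\<open>X\<close> bounds the cutoff \<open>N\<close> without rounding. \<open>a\<close>
  collects the constants: \<open>log 2 A\<close> from the size of \<open>v\<close>, and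
  \<open>d + 2\<close> from rounding the grid sizes up to integers.\<close>

lemma covering_number_exponential:
  fixes v :: "nat \<Rightarrow> 'h::real_normed_vector"
  assumes A: "A \<ge> 1" and d: "d \<ge> (1::nat)" and \<epsilon>: "0 < \<epsilon>" "\<epsilon> < 1"
    and v: "\<And>n. n \<ge> 1 \<Longrightarrow> norm (v n) \<le> A * (1 / 2) ^ (n * d)"
    and E: "\<And>f. f \<in> E \<Longrightarrow> \<exists>c. (\<forall>n\<ge>1. \<bar>c n\<bar> \<le> 1) \<and> ((\<lambda>n. c n *\<^sub>R v n) has_sum f) {1..}"
  defines "L \<equiv> log 2 (1 / \<epsilon>)" and "a \<equiv> real d + 2 + log 2 A"
  defines "X \<equiv> (L + a) / d + 1"
  shows "log2_enat (covering_number \<epsilon> E) \<le> ereal (X * (log 2 X + a + L / 2))"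
proof -
  have L: "L > 0" using \<epsilon> by (simp add: L_def)
  have A0: "log 2 A \<ge> 0" using A by simp
  have a: "a > 0" using A0 by (simp add: a_def)
  have pL: "2 powr L = 1 / \<epsilon>" using \<epsilon> by (simp add: L_def)
  have pA: "2 powr (log 2 A) = A" using A by simp
  have half: "(1 / 2 :: real) ^ k = 2 powr (- real k)" for k
    by (simp add: powr_minus powr_realpow power_one_over inverse_eq_divide)
  \<comment> \<open>\<open>x\<close> solves \<open>A * 2 powr (- x * d) = \<epsilon> / 2\<close>, so
    truncation at any \<open>N \<ge> x\<close> leaves at most half of \<epsilon>.\<close>
  define x where "x = (L + 1 + log 2 A) / d"
  have x: "x > 0" using L A0 d by (simp add: x_def)
  define N where "N = nat \<lceil>x\<rceil>"
  have N: "x \<le> N" "N < x + 1" unfolding N_def using x by linarith+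
  have N1: "N \<ge> 1" using N x by linarith
  have NX: "N \<le> X"
  proof -
    have "x \<le> (L + a) / d" unfolding x_def a_def using d by (intro divide_right_mono) auto
    then show ?thesis using N by (simp add: X_def)
  qed
  have Nd: "L + 1 + log 2 A \<le> real N * d" "real N * d < L + 1 + log 2 A + d"
    using N d by (auto simp: x_def field_simps)
  \<comment> \<open>The factor \<open>4 * N / \<epsilon>\<close> makes each rounding error at most
    \<open>\<epsilon> / (4 * N)\<close>. Together they take a quarter of \<epsilon>, so the total
    including the tail stays strictly below \<epsilon>.\<close>
  define m where "m n = nat \<lceil>4 * N * (A * (1 / 2) ^ (n * d)) / \<epsilon>\<rceil>" for n
  have pos: "4 * N * (A * (1 / 2) ^ (n * d)) / \<epsilon> > 0" for n using N1 A \<epsilon> by auto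
  have m: "m n \<ge> 4 * N * (A * (1 / 2) ^ (n * d)) / \<epsilon>" "m n < 4 * N * (A * (1 / 2) ^ (n * d)) / \<epsilon> + 1" for n
    unfolding m_def using pos[of n] by linarith+
  have m0: "m n > 0" for n using m(1)[of n] pos[of n] by linarith
  have "covering_number \<epsilon> E \<le> enat (\<Prod>n\<in>{1..N}. m n)"
  proof (rule covering_number_prod[where v = v and T = "A * (1 / 2) ^ (N * d)"])
    show "(\<Sum>n\<in>F. norm (v n)) \<le> A * (1 / 2) ^ (N * d)" if F: "finite F" "F \<subseteq> {N<..}" for F
    proof -
      have "(\<Sum>n\<in>F. norm (v n)) \<le> (\<Sum>n\<in>F. A * (1 / 2) ^ (n * d))"
        using F by (intro sum_mono v) auto
      also have "\<dots> \<le> A * (1 / 2) ^ (N * d)"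
        unfolding sum_distrib_left[symmetric] using A sum_geometric_tail[OF F d]
        by (intro mult_left_mono) auto
      finally show ?thesis .
    qed
    have "(\<Sum>n\<in>{1..N}. norm (v n) / m n) \<le> (\<Sum>n\<in>{1..N}. \<epsilon> / (4 * N))"
    proof (rule sum_mono)
      fix n assume n: "n \<in> {1..N}"
      have "norm (v n) \<le> A * (1 / 2) ^ (n * d)" using v n by simp
      also have "\<dots> \<le> \<epsilon> / (4 * N) * m n" using m(1)[of n] N1 \<epsilon> by (simp add: field_simps)
      finally show "norm (v n) / m n \<le> \<epsilon> / (4 * N)" using m0[of n] by (simp add: pos_divide_le_eq)
    qed
    also have "\<dots> = \<epsilon> / 4" using N1 by simp
    finally have 1: "(\<Sum>n\<in>{1..N}. norm (v n) / m n) \<le> \<epsilon> / 4" .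
    have "(1 / 2 :: real) ^ (N * d) \<le> 2 powr (- L - 1 - log 2 A)"
      unfolding half using Nd by (intro powr_mono) auto
    also have "\<dots> = \<epsilon> / 2 / A" using \<epsilon> A by (simp add: powr_diff powr_minus pL pA)
    finally have "A * (1 / 2) ^ (N * d) \<le> \<epsilon> / 2" using A by (simp add: field_simps)
    then show "(\<Sum>n\<in>{1..N}. norm (v n) / m n) + A * (1 / 2) ^ (N * d) < \<epsilon>" using 1 \<epsilon> by linarith
  qed (use E m0 in auto)
  then have "log2_enat (covering_number \<epsilon> E) \<le> ereal (log 2 (real (\<Prod>n\<in>{1..N}. m n)))"
    by (rule log2_enat_le)
  also have "log 2 (real (\<Prod>n\<in>{1..N}. m n)) = (\<Sum>n\<in>{1..N}. log 2 (m n))"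
    using m0 by (simp add: log_def ln_prod sum_divide_distrib)
  also have "\<dots> \<le> (\<Sum>n\<in>{1..N}. log 2 N + a + L - real d * n)"
  proof (rule sum_mono)
    fix n assume n: "n \<in> {1..N}"
    define r where "r = A * (1 / 2) ^ (n * d) / \<epsilon>"
    have r: "r = 2 powr (log 2 A + L - real d * n)"
    proof -
      have "log 2 A + L - real d * n = log 2 A + L + - real (n * d)" by simp
      then show ?thesis by (simp only: powr_add pL pA half r_def) simp
    qed
    \<comment> \<open>Rounding up in \<open>m n\<close> adds at most 1. Since
      \<open>n \<le> N\<close>, the value \<open>r\<close> is at least
      \<open>2 powr (- (d + 1))\<close>, so this 1 is absorbed into a multiple of
      \<open>r\<close>.\<close>
    have "real d * n \<le> real N * d" using n by (subst mult.commute) (intro mult_right_mono, auto)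
    then have "0 \<le> log 2 A + L - real d * n + (d + 1)" using Nd(2) by simp
    then have "1 \<le> 2 powr (log 2 A + L - real d * n + (d + 1))" by (intro ge_one_powr_ge_zero) auto
    also have "\<dots> = r * 2 ^ (d + 1)" unfolding r powr_add by (simp flip: powr_realpow add: powr_add)
    finally have r1: "1 \<le> r * 2 ^ (d + 1)" .
    have r0: "r \<ge> 0" by (simp add: r)
    have "2 ^ (d + 1) \<ge> (2 ^ (1 + 1) :: real)" using d by (intro power_increasing) auto
    then have d4: "4 * real N \<le> 2 ^ (d + 1) * real N" by (intro mult_right_mono) auto
    have d2: "2 ^ (d + 1) * 1 \<le> 2 ^ (d + 1) * real N" using N1 by (intro mult_left_mono) auto
    have "m n \<le> 4 * N * r + 1" using m(2)[of n] by (simp add: r_def)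
    also have "\<dots> \<le> (4 * real N + 2 ^ (d + 1)) * r" using r1 by (simp add: algebra_simps)
    also have "\<dots> \<le> (real N * 2 ^ (d + 2)) * r"
    proof (rule mult_right_mono[OF _ r0])
      have "real N * 2 ^ (d + 2) = 2 ^ (d + 1) * real N + 2 ^ (d + 1) * real N" by simp
      then show "4 * real N + 2 ^ (d + 1) \<le> real N * 2 ^ (d + 2)" using d4 d2 by linarith
    qed
    also have "\<dots> = 2 powr (log 2 N + a + L - real d * n)"
    proof -
      have "log 2 N + a + L - real d * n = log 2 N + real (d + 2) + (log 2 A + L - real d * n)"
        by (simp add: a_def)
      then show ?thesis using N1 by (simp only: r powr_add powr_realpow) simp
    qed
    finally have "log 2 (m n) \<le> log 2 (2 powr (log 2 N + a + L - real d * n))"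
      using m0[of n] by (intro log_mono) auto
    then show "log 2 (m n) \<le> log 2 N + a + L - real d * n" by simp
  qed
  also have "\<dots> = N * (log 2 N + a + L - (real N + 1) * d / 2)"
  proof -
    have "(\<Sum>n\<in>{1..M}. b - real d * n) = M * (b - (real M + 1) * d / 2)" for M :: nat and b :: real
      by (induction M) (simp_all add: field_simps)
    then show ?thesis .
  qed
  \<comment> \<open>The mean of \<open>L - d * n\<close> over \<open>n \<le> N\<close> is
    \<open>L - (N + 1) * d / 2\<close>, at most \<open>L / 2\<close> because the cutoff exceeds
    \<open>L / d\<close>. This halving produces \<open>1 / (2 * d)\<close> in place of
    \<open>1 / d\<close>.\<close>
  also have "\<dots> \<le> N * (log 2 N + a + L / 2)"
  proof (intro mult_left_mono)
    have "L \<le> (real N + 1) * d" using Nd A0 by (simp add: algebra_simps)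
    then show "log 2 N + a + L - (real N + 1) * d / 2 \<le> log 2 N + a + L / 2" by simp
  qed simp
  \<comment> \<open>Replacing \<open>N\<close> by \<open>X\<close> leaves an explicit function of
    \<open>L\<close>, whose limit can be computed.\<close>
  also have "\<dots> \<le> X * (log 2 X + a + L / 2)"
    using NX N1 a L by (intro mult_mono add_mono log_mono add_nonneg_nonneg order_refl) auto
  finally show ?thesis by simp
qed

section \<open>Asymptotics as \<epsilon> tends to 0\<close>

lemma covering_limit:
  fixes d a :: real assumes "d > 0" "a > 0"
  shows "((\<lambda>L. ((L + a) / d + 1) * (log 2 ((L + a) / d + 1) + a + L / 2) / L\<^sup>2) \<longlongrightarrow> 1 / (2 * d)) at_top"
  \<comment> \<open>The leading factors are \<open>L / d\<close> and \<open>L / 2\<close>; the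
    logarithm is of lower order.\<close>
  using assms unfolding log_def by (real_asymp simp: field_simps)

text \<open>The asymptotic estimate misses only finitely many \<open>n\<close>; the constant absorbs
  their ratios by summing them. The summand 1 in \<open>C\<close> keeps its logarithm
  nonnegative.\<close>

lemma bigo_uniform_bound:
  fixes f g :: "nat \<Rightarrow> real"
  assumes "f \<in> O(g)" and g: "\<And>n. g n > 0"
  obtains C where "C \<ge> 1" "\<And>n. f n \<le> C * g n"
proof -
  obtain c M where c: "\<And>n. n \<ge> M \<Longrightarrow> \<bar>f n\<bar> \<le> c * \<bar>g n\<bar>"
    using assms(1) by (elim landau_o.bigE) (auto simp: eventually_sequentially)
  define C where "C = 1 + \<bar>c\<bar> + (\<Sum>n<M. \<bar>f n / g n\<bar>)"
  have s: "(\<Sum>n<M. \<bar>f n / g n\<bar>) \<ge> 0" by (intro sum_nonneg) auto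
  have "f n / g n \<le> C" for n
  proof (cases "n < M")
    case True
    then have "\<bar>f n / g n\<bar> \<le> (\<Sum>n<M. \<bar>f n / g n\<bar>)" by (intro member_le_sum) auto
    then show ?thesis unfolding C_def by linarith
  next
    case False
    then have "f n / g n \<le> c" using c[of n] g[of n] by (simp add: pos_divide_le_eq)
    then show ?thesis using s by (simp add: C_def)
  qed
  then have "f n \<le> C * g n" for n using pos_divide_le_eq[OF g[of n]] by metis
  moreover have "C \<ge> 1" using s by (simp add: C_def)
  ultimately show ?thesis using that by blast
qed

theorem theorem4p3:
  fixes B :: "nat \<Rightarrow> (real ^ 'd) set"
    and J :: "(real ^ 'd \<Rightarrow> real) \<Rightarrow> 'h::{real_inner, complete_space}"
    and J2 :: "((real ^ 'd) \<times> (real ^ 'd) \<Rightarrow> real) \<Rightarrow> 'k::{real_inner, complete_space}"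
    and K :: 'k
    and lam :: "nat \<Rightarrow> real"
  assumes "ks_cube_sequence B"
    and "L1_completion (ks_inner B) J"
    and "L1_completion (ks_inner2 B) J2"
    and "((\<lambda>n. lam n *\<^sub>R J2 (\<lambda>(x, y). ks_Y B n x * ks_Y B n y)) has_sum K) {1..}"
    and "\<And>n. n \<ge> 1 \<Longrightarrow> lam n > 0"
    and "lam \<in> O(\<lambda>n. 2 powr (- (real n * (2 * real CARD('d) + 1))))"
  shows "Limsup (at_right 0)
           (\<lambda>\<epsilon>::real. log2_enat (covering_number \<epsilon> (rkhs_unit_ball (\<lambda>n. J (ks_Y B n)) lam))
                        / ereal ((log 2 (1 / \<epsilon>))\<^sup>2))
         \<le> ereal (2 / (2 * real CARD('d) + 1))"
proof -
  define d where "d = CARD('d)"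
  have d: "d \<ge> 1" by (simp add: d_def Suc_leI)
  define Y where "Y n = J (ks_Y B n)" for n
  define v where "v n = sqrt (lam n) *\<^sub>R Y n" for n
  obtain C where C: "C \<ge> 1" "\<And>n. lam n \<le> C * 2 powr (- (real n * (2 * real d + 1)))"
    using bigo_uniform_bound[OF assms(6)] by (auto simp: d_def)
  \<comment> \<open>The growth \<open>2 ^ (n - 1)\<close> of the square norm of \<open>Y n\<close>
    uses up the \<open>+ 1\<close> in the decay exponent \<open>2 * d + 1\<close>; the square root
    of the remaining \<open>2 powr (- 2 * n * d)\<close> gives the rate.\<close>
  have v: "norm (v n) \<le> sqrt C * (1 / 2) ^ (n * d)" if n: "n \<ge> 1" for n
  proof (rule power2_le_imp_le)
    have "(norm (v n))\<^sup>2 = lam n * (norm (Y n))\<^sup>2"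
      using assms(5)[OF n] by (simp add: v_def power_mult_distrib)
    also have "\<dots> \<le> (C * 2 powr (- (real n * (2 * real d + 1)))) * 2 ^ (n - 1)"
      using C norm_J_ks_Y_le[OF assms(1,2) n] by (intro mult_mono) (auto simp: Y_def)
    also have "\<dots> \<le> (C * 2 powr (- (real n * (2 * real d + 1)))) * 2 ^ n"
      using C(1) by (intro mult_left_mono power_increasing) auto
    also have "\<dots> = C * 2 powr (- (real (2 * (n * d))))"
      by (simp add: algebra_simps flip: powr_realpow powr_add)
    also have "\<dots> = C * (1 / 2) ^ (2 * (n * d))"
      unfolding powr_minus by (subst powr_realpow) (simp_all add: power_one_over inverse_eq_divide)
    also have "\<dots> = (sqrt C * (1 / 2) ^ (n * d))\<^sup>2"
      using C(1) by (simp add: power_mult_distrib power_mult mult.commute[of 2])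
    finally show "(norm (v n))\<^sup>2 \<le> (sqrt C * (1 / 2) ^ (n * d))\<^sup>2" .
  qed (use C in auto)
  \<comment> \<open>Summability ensures that least-norm coefficients exist. The geometric tail bound
    at cutoff 0 controls the whole series.\<close>
  have summ: "(\<lambda>n. norm (sqrt (lam n) *\<^sub>R Y n)) summable_on {1..}"
  proof (rule nonneg_bounded_partial_sums_imp_summable_on[where C = "sqrt C"])
    have "(\<Sum>n\<in>F. norm (v n)) \<le> sqrt C" if F: "finite F" "F \<subseteq> {1..}" for F
    proof -
      have "(\<Sum>n\<in>F. norm (v n)) \<le> (\<Sum>n\<in>F. sqrt C * (1 / 2) ^ (n * d))"
        using F by (intro sum_mono v) auto
      also have "\<dots> \<le> sqrt C * 1"
        unfolding sum_distrib_left[symmetric] using C sum_geometric_tail[of F 0 d] F d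
        by (intro mult_left_mono) (auto simp: subset_iff Suc_le_eq)
      finally show ?thesis by simp
    qed
    then show "\<forall>\<^sub>F F in finite_subsets_at_top {1..}. (\<Sum>n\<in>F. norm (sqrt (lam n) *\<^sub>R Y n)) \<le> sqrt C"
      unfolding v_def by (intro eventually_finite_subsets_at_top_weakI)
  qed auto
  define a where "a = real d + 2 + log 2 (sqrt C)"
  define h where "h L = ((L + a) / d + 1) * (log 2 ((L + a) / d + 1) + a + L / 2)" for L
  have a: "a > 0" using C by (simp add: a_def add_pos_nonneg)
  have bound: "log2_enat (covering_number \<epsilon> (rkhs_unit_ball Y lam)) / ereal ((log 2 (1 / \<epsilon>))\<^sup>2)
      \<le> ereal (h (log 2 (1 / \<epsilon>)) / (log 2 (1 / \<epsilon>))\<^sup>2)" if \<epsilon>: "0 < \<epsilon>" "\<epsilon> < 1" for \<epsilon>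
  proof -
    have "log2_enat (covering_number \<epsilon> (rkhs_unit_ball Y lam)) \<le> ereal (h (log 2 (1 / \<epsilon>)))"
      unfolding h_def a_def
    proof (rule covering_number_exponential[OF _ d \<epsilon> v])
      fix f assume "f \<in> rkhs_unit_ball Y lam"
      then show "\<exists>c. (\<forall>n\<ge>1. \<bar>c n\<bar> \<le> 1) \<and> ((\<lambda>n. c n *\<^sub>R v n) has_sum f) {1..}"
        unfolding v_def using rkhs_unit_ballE[OF summ] by metis
    qed (use C in auto)
    moreover have "log 2 (1 / \<epsilon>) > 0" using \<epsilon> by simp
    then have "(log 2 (1 / \<epsilon>))\<^sup>2 > 0" by (rule zero_less_power)
    ultimately show ?thesis
      using ereal_divide_right_mono[of _ "ereal (h (log 2 (1 / \<epsilon>)))" "ereal ((log 2 (1 / \<epsilon>))\<^sup>2)"] by auto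
  qed
  have "filterlim (\<lambda>\<epsilon>::real. log 2 (1 / \<epsilon>)) at_top (at_right 0)"
    unfolding log_def by real_asymp
  moreover have "((\<lambda>L. h L / L\<^sup>2) \<longlongrightarrow> 1 / (2 * real d)) at_top"
    unfolding h_def using covering_limit[of d a] a d by simp
  ultimately have "((\<lambda>\<epsilon>. ereal (h (log 2 (1 / \<epsilon>)) / (log 2 (1 / \<epsilon>))\<^sup>2)) \<longlongrightarrow> ereal (1 / (2 * real d))) (at_right 0)"
    by (intro tendsto_ereal) (rule filterlim_compose)
  then have lim: "Limsup (at_right 0) (\<lambda>\<epsilon>. ereal (h (log 2 (1 / \<epsilon>)) / (log 2 (1 / \<epsilon>))\<^sup>2)) = ereal (1 / (2 * real d))"
    by (intro lim_imp_Limsup) auto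
  have "Limsup (at_right 0)
      (\<lambda>\<epsilon>. log2_enat (covering_number \<epsilon> (rkhs_unit_ball Y lam)) / ereal ((log 2 (1 / \<epsilon>))\<^sup>2))
      \<le> Limsup (at_right 0) (\<lambda>\<epsilon>. ereal (h (log 2 (1 / \<epsilon>)) / (log 2 (1 / \<epsilon>))\<^sup>2))"
  proof (rule Limsup_mono)
    show "\<forall>\<^sub>F \<epsilon> in at_right 0.
        log2_enat (covering_number \<epsilon> (rkhs_unit_ball Y lam)) / ereal ((log 2 (1 / \<epsilon>))\<^sup>2)
        \<le> ereal (h (log 2 (1 / \<epsilon>)) / (log 2 (1 / \<epsilon>))\<^sup>2)"
      \<comment> \<open>Restricting to \<open>\<epsilon> < 1\<close> makes
        \<open>log 2 (1 / \<epsilon>)\<close> positive, as \<open>bound\<close> requires.\<close>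
      using eventually_at_right_real[of 0 "1::real", OF zero_less_one]
    proof eventually_elim
      case (elim \<epsilon>)
      then have "0 < \<epsilon>" "\<epsilon> < 1" by simp_all
      then show ?case by (rule bound)
    qed
  qed
  \<comment> \<open>The comparison amounts to \<open>2 * d + 1 \<le> 4 * d\<close>, true for
    \<open>d \<ge> 1\<close>.\<close>
  also have "\<dots> \<le> ereal (2 / (2 * real d + 1))"
  proof -
    have "1 / (2 * real d) \<le> 2 / (2 * real d + 1)"
      using d by (simp add: divide_simps)
    then show ?thesis unfolding lim by (simp only: ereal_less_eq)
  qed
  finally show ?thesis unfolding Y_def d_def .
qed

end
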